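(* Let $n>1$ be an integer and let $m=p^t$ be a prime power for some prime $p$ and some integer $t\geq 0$. Then $\text{ord}_p(g(m,n)) = 1$ if $n$ is a power of $p$, and $\text{ord}_p(g(m,n)) = 0$ otherwise.
   Context: For a positive integer $m$ and an integer $n>1$, $g(m,n)$ denotes the greatest common divisor of the set of binomial coefficients $\left\{\binom{mn}{mk}: 1\leq k<n\right\}$, $k$ ranging over integers. For a prime $p$, $\text{ord}_p(a)$ denotes the $p$-adic valuation of the positive integer $a$, i.e. the largest integer $k$ such that $p^k$ divides $a$. "$n$ is a power of $p$" means $n=p^i$ for some integer $i\geq 0$. *)

theory Defs
  imports "HOL-Computational_Algebra.Primes"
begin

definition binom_gcd :: "nat \<Rightarrow> nat \<Rightarrow> nat" where
  "binom_gcd m n = Gcd {(m * n) choose (m * k) | k. 1 \<le> k \<and> k < n}"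

end

theory Submission
  imports Defs
begin

text \<open>
  Everything rests on the absorption identity \<open>j * (N choose j) = N * ((N - 1) choose (j - 1))\<close>
  with \<open>N = q * b\<close>, \<open>b > 0\<close> and \<open>q\<close> a power of \<open>p\<close>. If \<open>0 < j < q\<close>, then \<open>q\<close> divides the right-hand
  side but not \<open>j\<close>, so \<open>p\<close> divides \<open>N choose j\<close>. Pascal's rule turns this into
  \<open>(N - 1) choose j \<equiv> -((N - 1) choose (j - 1))\<close> modulo \<open>p\<close> for such \<open>j\<close>; starting from
  \<open>(N - 1) choose 0 = 1\<close>, none of these values is divisible by \<open>p\<close> as long as \<open>j < q\<close>.
  Absorption at \<open>j = q\<close> then shows that \<open>(q * b) choose q\<close> has the same \<open>p\<close>-adic valuation
  as \<open>b\<close> (\<open>multiplicity_choose_prime_power\<close>).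

  The theorem follows by looking at a single entry of the set whose gcd is taken. If \<open>p\<close> does not
  divide \<open>b\<close> and \<open>n = p ^ a * b\<close> with \<open>b > 1\<close>, the entry at \<open>k = p ^ a\<close> has the valuation of
  \<open>b\<close>, which is \<open>0\<close>. If \<open>n = p ^ i\<close>, then \<open>m * n\<close> is itself a power of \<open>p\<close>, so \<open>p\<close> divides all
  the entries, while the entry at \<open>k = p ^ (i - 1)\<close> has the valuation of \<open>b = p\<close>, which is \<open>1\<close>.
\<close>

lemma prime_dvd_choose_below_prime_power:
  fixes p s b j :: nat
  assumes "prime p" "0 < j" "j < p ^ s"
  shows "p dvd (p ^ s * b) choose j"
proof (rule ccontr)
  assume "\<not> p dvd (p ^ s * b) choose j"
  then have "coprime (p ^ s) ((p ^ s * b) choose j)"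
    using assms(1) by (simp add: prime_imp_coprime)
  moreover have "p ^ s dvd j * ((p ^ s * b) choose j)"
    using times_binomial_minus1_eq[OF assms(2), of "p ^ s * b"] by simp
  ultimately have "p ^ s dvd j"
    by (simp add: coprime_dvd_mult_left_iff)
  then show False
    using assms(2,3) by (simp add: nat_dvd_not_less)
qed

text \<open>
  By Pascal's rule two neighbouring entries of row \<open>p ^ s * b - 1\<close> add up to an entry of the next
  row, which is divisible by \<open>p\<close>; hence non-divisibility passes from each entry to the next.
\<close>

lemma prime_not_dvd_choose_pred_prime_power:
  fixes p s b j :: nat
  assumes "prime p" "0 < b" "j < p ^ s"
  shows "\<not> p dvd (p ^ s * b - 1) choose j"
  using assms(3)
proof (induction j)
  case 0
  then show ?case
    using prime_gt_1_nat[OF assms(1)] by simp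
next
  case (Suc j)
  have "p ^ s * b = Suc (p ^ s * b - 1)"
    using assms(1,2) by (simp add: prime_gt_0_nat)
  then have "(p ^ s * b) choose Suc j =
      ((p ^ s * b - 1) choose j) + ((p ^ s * b - 1) choose Suc j)"
    using binomial_Suc_Suc[of "p ^ s * b - 1" j] by simp
  moreover have "p dvd (p ^ s * b) choose Suc j"
    using prime_dvd_choose_below_prime_power[OF assms(1) _ Suc.prems] by simp
  ultimately show ?case
    using Suc dvd_add_left_iff[of p "(p ^ s * b - 1) choose Suc j" "(p ^ s * b - 1) choose j"]
    by auto
qed

lemma multiplicity_choose_prime_power:
  fixes p s b :: nat
  assumes "prime p" "0 < b"
  shows "multiplicity p ((p ^ s * b) choose (p ^ s)) = multiplicity p b"
proof -
  have q: "0 < p ^ s"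
    using assms(1) by (simp add: prime_gt_0_nat)
  have "p ^ s * ((p ^ s * b) choose (p ^ s)) = p ^ s * (b * ((p ^ s * b - 1) choose (p ^ s - 1)))"
    using times_binomial_minus1_eq[OF q, of "p ^ s * b"] by (simp only: mult.assoc)
  then have "(p ^ s * b) choose (p ^ s) = b * ((p ^ s * b - 1) choose (p ^ s - 1))"
    using q by (metis mult_left_cancel not_gr0)
  moreover have "\<not> p dvd (p ^ s * b - 1) choose (p ^ s - 1)"
    using prime_not_dvd_choose_pred_prime_power[OF assms] q by simp
  ultimately show ?thesis
    using assms(1) by (simp add: multiplicity_prime_elem_times_other mult.commute[of b])
qed

theorem theorem1:
  fixes m n p t :: nat
  assumes "n > 1" and "prime p" and "m = p ^ t"
  shows "multiplicity p (binom_gcd m n) = (if \<exists>i::nat. n = p ^ i then 1 else 0)"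
proof -
  have bound: "multiplicity p (binom_gcd m n) \<le> multiplicity p b"
    if n: "n = p ^ a * b" and b: "1 < b" for a b
  proof -
    have "1 \<le> p ^ a" "p ^ a < n"
      using n b assms(2) by (simp_all add: prime_gt_0_nat Suc_le_eq)
    then have "binom_gcd m n dvd (m * n) choose (m * p ^ a)"
      unfolding binom_gcd_def by (intro Gcd_dvd) blast
    moreover have "(m * n) choose (m * p ^ a) = (p ^ (t + a) * b) choose (p ^ (t + a))"
      using assms(3) n by (simp add: power_add mult.assoc)
    moreover have "(p ^ (t + a) * b) choose (p ^ (t + a)) \<noteq> 0"
      using b by simp
    ultimately have "multiplicity p (binom_gcd m n)
        \<le> multiplicity p ((p ^ (t + a) * b) choose (p ^ (t + a)))"
      by (metis dvd_imp_multiplicity_le)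
    then show ?thesis
      using multiplicity_choose_prime_power[OF assms(2)] b by simp
  qed
  show ?thesis
  proof (cases "\<exists>i. n = p ^ i")
    case True
    then obtain i where n: "n = p ^ i"
      by blast
    with assms(1) obtain a where i: "i = Suc a"
      by (cases i) auto
    have "multiplicity p (binom_gcd m n) \<le> 1"
      using bound[of a p] n i prime_gt_1_nat[OF assms(2)] by (simp add: mult.commute multiplicity_self)
    moreover have "p dvd binom_gcd m n"
      unfolding binom_gcd_def
    proof (rule Gcd_greatest, safe)
      fix k assume "1 \<le> k" "k < n"
      then have "0 < m * k" "m * k < p ^ (t + i)"
        using assms(2,3) n by (simp_all add: power_add prime_gt_0_nat)
      then show "p dvd (m * n) choose (m * k)"
        using prime_dvd_choose_below_prime_power[OF assms(2), of "m * k" "t + i" 1] assms(3) n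
        by (simp add: power_add)
    qed
    \<comment> \<open>Divisibility by \<open>p\<close> gives a positive multiplicity only for nonzero numbers:
        \<open>multiplicity p 0\<close> is \<open>0\<close> by convention.\<close>
    moreover have "binom_gcd m n \<noteq> 0"
    proof -
      have "(m * n) choose m \<noteq> 0"
        using assms(1) by simp
      moreover have "binom_gcd m n dvd (m * n) choose (m * 1)"
        unfolding binom_gcd_def using assms(1) by (intro Gcd_dvd) blast
      ultimately show ?thesis
        by (metis dvd_0_left mult_1_right)
    qed
    ultimately have "multiplicity p (binom_gcd m n) = 1"
      using prime_gt_1_nat[OF assms(2)] multiplicity_gt_zero_iff[of "binom_gcd m n" p]
      by simp
    with True show ?thesis
      by simp
  next
    case False
    obtain b where n: "n = p ^ multiplicity p n * b" and b: "\<not> p dvd b"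
      using multiplicity_decompose'[of n p] assms(1) prime_gt_1_nat[OF assms(2)] by auto
    have "b \<noteq> 0"
      using b by (metis dvd_0_right)
    moreover have "b \<noteq> 1"
      using False n by auto
    ultimately have "multiplicity p (binom_gcd m n) \<le> multiplicity p b"
      using bound[OF n] by simp
    with False b show ?thesis
      by (simp add: not_dvd_imp_multiplicity_0)
  qed
qed

end
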